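(* Using the convention $r/0=\infty$ for all $r\in[0,\infty]$ and the notation $r^{+}=\max\{r,0\}$, we have \[\inf_{R\in\mathcal{R}}\max_{\mu\in\Delta} \frac{\mathrm{cost}(R,\mu)}{\mathrm{score}(R,\mu)^{+}} =\max_{\mu\in\Delta}\inf_{R\in\mathcal{R}} \frac{\mathrm{cost}(R,\mu)}{\mathrm{score}(R,\mu)^{+}},\] and both maximums over $\mu\in\Delta$ in this equation are attained. Moreover, if $\mathrm{cost}(R,\cdot)$ and $\mathrm{score}(R,\cdot)$ are both linear in $\mu$ for each $R\in\mathcal{R}$, then \[\inf_{R\in\mathcal{R}}\max_{x\in S} \frac{\mathrm{cost}(R,x)}{\mathrm{score}(R,x)^{+}} =\max_{\mu\in\Delta}\inf_{R\in\mathcal{R}} \frac{\mathrm{cost}(R,\mu)}{\mathrm{score}(R,\mu)^{+}},\] and the maximum over $x\in S$ and the maximum over $\mu\in\Delta$ in this equation are also attained.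
   Context: Let $V$ be a real topological vector space, and let $\mathcal{R}\subseteq V$ be convex. Let $S$ be a nonempty finite set, and let $\Delta$ be the set of all probability distributions over $S$, viewed as a subset of $\mathbb{R}^{|S|}$ (with $x\in S$ identified with the point mass on $x$, so $\mathrm{cost}(R,x)$, $\mathrm{score}(R,x)$ denote the values at that point mass). Let $\mathrm{cost}\colon\mathcal{R}\times\Delta\to[0,\infty]$ be semicontinuous and saddle, and let $\mathrm{score}\colon\mathcal{R}\times\Delta\to[-\infty,\infty)$ be such that its negation $-\mathrm{score}$ is semicontinuous and saddle. Here a function $\alpha\colon\mathcal{R}\times\Delta\to[-\infty,\infty]$ is saddle if $\alpha(\cdot,\mu)$ is convex for every $\mu$ and $\alpha(R,\cdot)$ is concave for every $R$, and semicontinuous if $\alpha(R,\cdot)$ is upper semicontinuous for every $R$ and $\alpha(\cdot,\mu)$ is lower semicontinuous for every $\mu$. Suppose $\mathrm{cost}$ and $\mathrm{score}$ are well-behaved, meaning: (1) for each $\mu\in\Delta$ there is $R\in\mathcal{R}$ with $0<\mathrm{cost}(R,\mu)<\infty$ and $\mathrm{score}(R,\mu)>0$; (2) for each $R\in\mathcal{R}$, either $\mathrm{cost}(R,\mu)=0$ for all $\mu\in\Delta$ or $\mathrm{cost}(R,\mu)>0$ for all $\mu\in\Delta$; (3) for each $\mu\in\Delta$, if $\mathrm{cost}(R,\mu)=0$ and $\mathrm{cost}(R',\mu)>0$ then $\mathrm{cost}(\lambda R+(1-\lambda)R',\mu)>0$ for all $\lambda\in(0,1)$. *)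

theory Defs
  imports "HOL-Analysis.Analysis"
begin

(* Not assumed to be Hausdorff. *)
class real_topological_vector_space = real_vector + topological_ab_group_add +
  assumes tendsto_scaleR_Pair:
    "LIM p (nhds c \<times>\<^sub>F nhds x). fst p *\<^sub>R snd p :> nhds (c *\<^sub>R x)"

instance real_normed_vector \<subseteq> real_topological_vector_space
proof
  fix c :: real and x :: 'a
  show "LIM p (nhds c \<times>\<^sub>F nhds x). fst p *\<^sub>R snd p :> nhds (c *\<^sub>R x)"
    by (intro tendsto_scaleR filterlim_fst filterlim_snd)
qed

(* The index set is a whole finite type, so it is nonempty; the point mass on x is axis x 1. *)
definition prob_simplex :: "(real ^ 's::finite) set" where
  "prob_simplex = {\<mu>. (\<forall>x. 0 \<le> \<mu> $ x) \<and> (\<Sum>x\<in>UNIV. \<mu> $ x) = 1}"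

(* On ereal, \<infinity> + (-\<infinity>) = \<infinity>, so the inequality is void whenever its right-hand side is
   undefined; defining concavity through the negated function keeps this for concavity. *)
definition ereal_convex_on :: "'a::real_vector set \<Rightarrow> ('a \<Rightarrow> ereal) \<Rightarrow> bool" where
  "ereal_convex_on A f \<longleftrightarrow> (\<forall>x\<in>A. \<forall>y\<in>A. \<forall>t\<in>{0<..<1::real}.
     f (t *\<^sub>R x + (1 - t) *\<^sub>R y) \<le> ereal t * f x + ereal (1 - t) * f y)"

definition ereal_concave_on :: "'a::real_vector set \<Rightarrow> ('a \<Rightarrow> ereal) \<Rightarrow> bool" where
  "ereal_concave_on A f \<longleftrightarrow> ereal_convex_on A (\<lambda>x. - f x)"

(* Linearity on a convex set: preservation of convex combinations. Meant for functions that do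
   not take both values \<infinity> and -\<infinity>. *)
definition ereal_linear_on :: "'a::real_vector set \<Rightarrow> ('a \<Rightarrow> ereal) \<Rightarrow> bool" where
  "ereal_linear_on A f \<longleftrightarrow> (\<forall>x\<in>A. \<forall>y\<in>A. \<forall>t\<in>{0<..<1::real}.
     f (t *\<^sub>R x + (1 - t) *\<^sub>R y) = ereal t * f x + ereal (1 - t) * f y)"

definition lower_semicontinuous_on :: "'a::topological_space set \<Rightarrow> ('a \<Rightarrow> ereal) \<Rightarrow> bool" where
  "lower_semicontinuous_on A f \<longleftrightarrow>
     (\<forall>x\<in>A. \<forall>a. a < f x \<longrightarrow> eventually (\<lambda>y. a < f y) (at x within A))"

definition upper_semicontinuous_on :: "'a::topological_space set \<Rightarrow> ('a \<Rightarrow> ereal) \<Rightarrow> bool" where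
  "upper_semicontinuous_on A f \<longleftrightarrow>
     (\<forall>x\<in>A. \<forall>a. f x < a \<longrightarrow> eventually (\<lambda>y. f y < a) (at x within A))"

definition saddle_on ::
  "'a::real_vector set \<Rightarrow> 'b::real_vector set \<Rightarrow> ('a \<Rightarrow> 'b \<Rightarrow> ereal) \<Rightarrow> bool" where
  "saddle_on A B \<alpha> \<longleftrightarrow>
     (\<forall>y\<in>B. ereal_convex_on A (\<lambda>x. \<alpha> x y)) \<and> (\<forall>x\<in>A. ereal_concave_on B (\<alpha> x))"

definition semicontinuous_on ::
  "'a::topological_space set \<Rightarrow> 'b::topological_space set \<Rightarrow> ('a \<Rightarrow> 'b \<Rightarrow> ereal) \<Rightarrow> bool" where
  "semicontinuous_on A B \<alpha> \<longleftrightarrow>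
     (\<forall>x\<in>A. upper_semicontinuous_on B (\<alpha> x)) \<and>
     (\<forall>y\<in>B. lower_semicontinuous_on A (\<lambda>x. \<alpha> x y))"

definition well_behaved ::
  "'v::real_vector set \<Rightarrow> 'm set \<Rightarrow> ('v \<Rightarrow> 'm \<Rightarrow> ereal) \<Rightarrow> ('v \<Rightarrow> 'm \<Rightarrow> ereal) \<Rightarrow> bool" where
  "well_behaved \<R> \<Delta> cost score \<longleftrightarrow>
     (\<forall>\<mu>\<in>\<Delta>. \<exists>R\<in>\<R>. 0 < cost R \<mu> \<and> cost R \<mu> < \<infinity> \<and> 0 < score R \<mu>) \<and>
     (\<forall>R\<in>\<R>. (\<forall>\<mu>\<in>\<Delta>. cost R \<mu> = 0) \<or> (\<forall>\<mu>\<in>\<Delta>. 0 < cost R \<mu>)) \<and>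
     (\<forall>\<mu>\<in>\<Delta>. \<forall>R\<in>\<R>. \<forall>R'\<in>\<R>. cost R \<mu> = 0 \<and> 0 < cost R' \<mu> \<longrightarrow>
        (\<forall>t\<in>{0<..<1::real}. 0 < cost (t *\<^sub>R R + (1 - t) *\<^sub>R R') \<mu>))"

(* c / s\<^sup>+ with r / 0 = \<infinity> for all r (the division of type ereal has 0 / 0 = 0). *)
definition pos_ratio :: "ereal \<Rightarrow> ereal \<Rightarrow> ereal" where
  "pos_ratio c s = (if max s 0 = 0 then \<infinity> else c / max s 0)"

end

theory Submission
  imports Defs
begin

text \<open>
  For real \<open>l > 0\<close>, the ratio is below \<open>l\<close> exactly where \<open>cost - l * score < 0\<close>, and this gap is
  convex in \<open>R\<close>, concave and upper semicontinuous in \<open>\<mu>\<close>. A concave upper semicontinuous function that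
  takes the value \<open>\<infinity>\<close> somewhere on a convex set is identically \<open>\<infinity>\<close> there, so only the strategies \<open>R\<close>
  whose gap is finite everywhere matter. If every \<open>\<mu>\<close> admits an \<open>R\<close> with negative gap, then
  compactness of the simplex reduces to finitely many \<open>R\<close>, and Kneser's induction merges these into one
  \<open>R\<close> with negative gap for all \<open>\<mu>\<close>; the step that merges two strategies is a separation in the plane.
\<close>

section \<open>A strategy that is negative everywhere, for real convex-concave functions\<close>

lemma convex_on_segmentD:
  fixes f :: "'a::real_vector \<Rightarrow> real"
  assumes "convex_on A f" "x \<in> A" "y \<in> A" "0 \<le> t" "t \<le> 1"
  shows "f (t *\<^sub>R x + (1 - t) *\<^sub>R y) \<le> t * f x + (1 - t) * f y"
  using convex_onD[OF assms(1), of "1 - t" x y] assms by simp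

lemma concave_on_segmentD:
  fixes f :: "'a::real_vector \<Rightarrow> real"
  assumes "concave_on A f" "x \<in> A" "y \<in> A" "0 \<le> t" "t \<le> 1"
  shows "t * f x + (1 - t) * f y \<le> f (t *\<^sub>R x + (1 - t) *\<^sub>R y)"
  using convex_on_segmentD[of A "\<lambda>x. - f x" x y t] assms by (simp add: concave_on_def)

text \<open>Compactness leaves a uniform slack \<open>e\<close>. Then no pair
  \<open>(h x + e, k x + e)\<close> lies in the closed nonnegative quadrant, and a line separates
  the quadrant from these pairs and everything below them. The normalised coefficients of that line
  are the weights \<open>t\<close> and \<open>1 - t\<close>; the slack makes the final inequality
  strict.\<close>

lemma two_concave_functions_alternative:
  fixes h k :: "'a::{real_vector, t2_space} \<Rightarrow> real"
  assumes X: "compact X" "convex X"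
    and conc: "concave_on X h" "concave_on X k"
    and clh: "\<And>a. closed {x\<in>X. a \<le> h x}" and clk: "\<And>a. closed {x\<in>X. a \<le> k x}"
    and neg: "\<And>x. x \<in> X \<Longrightarrow> h x < 0 \<or> k x < 0"
  obtains t where "0 \<le> t" "t \<le> 1" "\<And>x. x \<in> X \<Longrightarrow> t * h x + (1 - t) * k x < 0"
proof (cases "X = {}")
  case True
  then show ?thesis using that[of 0] by auto
next
  case False
  \<comment> \<open>\<open>C n\<close> holds the points where both functions are at least
    \<open>- 1 / (n + 1)\<close>. These sets shrink with \<open>n\<close> and have no common point,
    so compactness empties one of them.\<close>
  define C where "C n = {x\<in>X. - inverse (real (Suc n)) \<le> h x} \<inter> {x\<in>X. - inverse (real (Suc n)) \<le> k x}"
    for n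
  have clC: "closed (C n)" for n
    unfolding C_def by (intro closed_Int clh clk)
  have decC: "C n \<subseteq> C m" if "m \<le> n" for m n
  proof -
    have "inverse (real (Suc n)) \<le> inverse (real (Suc m))" using that by (simp add: field_simps)
    then have "- inverse (real (Suc m)) \<le> r" if "- inverse (real (Suc n)) \<le> r" for r
      using that by linarith
    then show ?thesis unfolding C_def by blast
  qed
  have "X \<inter> (\<Inter>n. C n) = {}"
  proof (rule ccontr)
    assume "X \<inter> (\<Inter>n. C n) \<noteq> {}"
    then obtain x where x: "x \<in> X" "\<And>n. x \<in> C n" by auto
    obtain d where d: "0 < d" "h x \<le> - d \<or> k x \<le> - d"
      using neg[OF x(1)] by (metis add.inverse_inverse neg_0_less_iff_less order_refl)
    obtain n where "inverse (real (Suc n)) < d" using d(1) reals_Archimedean by blast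
    then show False using x(2)[of n] d(2) unfolding C_def by auto
  qed
  then obtain n where Cn: "C n = {}"
  proof -
    have "\<exists>F. finite F \<and> X \<inter> (\<Inter>n\<in>F. C n) = {}"
      using compact_imp_fip_image[OF X(1), of UNIV C] clC \<open>X \<inter> (\<Inter>n. C n) = {}\<close> by blast
    then obtain F where F: "finite F" "X \<inter> (\<Inter>n\<in>F. C n) = {}" by blast
    \<comment> \<open>By monotonicity the set of largest index lies in all the others; inserting
      \<open>0\<close> gives \<open>Max\<close> a value when \<open>F\<close> is empty.\<close>
    have "C (Max (insert 0 F)) \<subseteq> X \<inter> (\<Inter>n\<in>F. C n)"
    proof -
      have "C (Max (insert 0 F)) \<subseteq> C m" if "m \<in> F" for m
        using that F(1) by (intro decC) auto
      moreover have "C (Max (insert 0 F)) \<subseteq> X" unfolding C_def by auto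
      ultimately show ?thesis by blast
    qed
    then have "C (Max (insert 0 F)) = {}" unfolding F(2) by (simp only: subset_empty)
    then show ?thesis by (rule that)
  qed
  define e where "e = inverse (real (Suc n))"
  have e: "0 < e" unfolding e_def by simp
  have sep: "h x + e < 0 \<or> k x + e < 0" if "x \<in> X" for x
  proof -
    have "x \<notin> C n" using Cn by simp
    then have "\<not> (- e \<le> h x \<and> - e \<le> k x)" using that unfolding C_def e_def by blast
    then show ?thesis by linarith
  qed
  \<comment> \<open>Closing the image of \<open>X\<close> downward is what makes it convex:
    concavity only bounds the values at a mixture from below.\<close>
  define A where "A = {p :: real \<times> real. \<exists>x\<in>X. fst p \<le> h x + e \<and> snd p \<le> k x + e}"
  define B where "B = {p :: real \<times> real. 0 \<le> fst p \<and> 0 \<le> snd p}"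
  have "convex A"
    unfolding convex_alt
  proof clarify
    fix a b c d u :: real
    assume "(a, b) \<in> A" "(c, d) \<in> A" and u: "0 \<le> u" "u \<le> 1"
    then obtain x y where xy: "x \<in> X" "y \<in> X" "a \<le> h x + e" "b \<le> k x + e" "c \<le> h y + e" "d \<le> k y + e"
      unfolding A_def by auto
    let ?z = "u *\<^sub>R y + (1 - u) *\<^sub>R x"
    have "?z \<in> X" using convexD[OF X(2) xy(2,1), of u "1 - u"] u by simp
    moreover have "(1 - u) * a + u * c \<le> (1 - u) * (h x + e) + u * (h y + e)"
      "(1 - u) * b + u * d \<le> (1 - u) * (k x + e) + u * (k y + e)"
      using u xy by (auto intro!: add_mono mult_left_mono)
    moreover note concave_on_segmentD[OF conc(1) xy(2,1) u] concave_on_segmentD[OF conc(2) xy(2,1) u]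
    ultimately have "?z \<in> X \<and> (1 - u) * a + u * c \<le> h ?z + e \<and> (1 - u) * b + u * d \<le> k ?z + e"
      by (simp add: algebra_simps)
    then show "(1 - u) *\<^sub>R (a, b) + u *\<^sub>R (c, d) \<in> A"
      unfolding A_def by auto
  qed
  moreover have "convex B"
    unfolding convex_alt B_def by auto
  moreover have "A \<noteq> {}" using False unfolding A_def by force
  moreover have "B \<noteq> {}" unfolding B_def by force
  moreover have "A \<inter> B = {}"
    using sep unfolding A_def B_def by fastforce
  ultimately obtain w b where w: "w \<noteq> 0" "\<forall>p\<in>A. inner w p \<le> b" "\<forall>p\<in>B. b \<le> inner w p"
    using separating_hyperplane_sets by metis
  obtain w1 w2 where w12: "w = (w1, w2)" by (cases w)
  have b0: "b \<le> 0" using w(3)[rule_format, of "(0,0)"] unfolding B_def w12 by auto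
  have B1: "b \<le> w1 * r" and B2: "b \<le> w2 * r" if "0 \<le> r" for r
    using w(3)[rule_format, of "(r,0)"] w(3)[rule_format, of "(0,r)"] that unfolding B_def w12 by auto
  \<comment> \<open>\<open>B\<close> contains both half-axes, so a negative coefficient
    \<open>v\<close> would drive \<open>v * r\<close> below \<open>b\<close>. The choice
    \<open>r = (b - 1) / v\<close> gives exactly \<open>b - 1\<close>, and \<open>r\<close> is
    nonnegative because \<open>b <= 0\<close>.\<close>
  have nonneg: "0 \<le> v" if "\<And>r. 0 \<le> r \<Longrightarrow> b \<le> v * r" for v :: real
  proof (rule ccontr)
    assume v: "\<not> 0 \<le> v"
    then have "b \<le> v * ((b - 1) / v)" using b0 by (intro that) (simp add: divide_nonpos_neg)
    with v show False by simp
  qed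
  have w0: "0 \<le> w1" "0 \<le> w2" by (auto intro: nonneg B1 B2)
  with w(1) w12 have s: "0 < w1 + w2" by (auto simp: zero_prod_def less_le)
  show ?thesis
  proof (rule that[of "w1 / (w1 + w2)"])
    fix x assume x: "x \<in> X"
    have "w1 * (h x + e) + w2 * (k x + e) \<le> b"
      using w(2)[rule_format, of "(h x + e, k x + e)"] x unfolding A_def w12 by auto
    then have "w1 * h x + w2 * k x \<le> - (w1 + w2) * e" using b0 by (simp add: algebra_simps)
    also have "\<dots> < 0" using s e by (intro mult_neg_pos) auto
    finally have "(w1 * h x + w2 * k x) / (w1 + w2) < 0" using s by (simp add: divide_neg_pos)
    moreover have "1 - w1 / (w1 + w2) = w2 / (w1 + w2)" using s by (simp add: field_simps)
    ultimately show "w1 / (w1 + w2) * h x + (1 - w1 / (w1 + w2)) * k x < 0"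
      by (simp add: add_divide_distrib)
  qed (use s w0 in auto)
qed

text \<open>Induction on \<open>F\<close> with \<open>X\<close> varying. On the part of
  \<open>X\<close> where \<open>g z\<close> is nonnegative, which is again compact and convex, the
  remaining strategies suffice, so the induction hypothesis gives one \<open>y\<close> that is
  negative there. At each point of \<open>X\<close> now \<open>z\<close> or \<open>y\<close> is
  negative, and the two are merged.\<close>

lemma kneser_alternative_finite:
  fixes g :: "'v::real_vector \<Rightarrow> 'a::{real_vector, t2_space} \<Rightarrow> real"
  assumes Y: "convex Y" "Y \<noteq> {}" and F: "finite F" "F \<subseteq> Y"
    and X: "compact X" "convex X"
    and cvx: "\<And>x. x \<in> X \<Longrightarrow> convex_on Y (\<lambda>y. g y x)"
    and conc: "\<And>y. y \<in> Y \<Longrightarrow> concave_on X (g y)"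
    and cl: "\<And>y a. y \<in> Y \<Longrightarrow> closed {x\<in>X. a \<le> g y x}"
    and neg: "\<And>x. x \<in> X \<Longrightarrow> \<exists>y\<in>F. g y x < 0"
  shows "\<exists>y\<in>Y. \<forall>x\<in>X. g y x < 0"
  using F X cvx conc cl neg
proof (induction F arbitrary: X rule: finite_induct)
  case empty
  then have "X = {}" by auto
  then show ?case using Y by auto
next
  case (insert z F)
  let ?K = "{x\<in>X. 0 \<le> g z x}"
  have z: "z \<in> Y" using insert.prems by auto
  have cvK: "convex ?K"
    unfolding convex_alt
  proof clarify
    fix x y and u :: real
    assume xy: "x \<in> X" "y \<in> X" "0 \<le> g z x" "0 \<le> g z y" and u: "0 \<le> u" "u \<le> 1"
    have "u *\<^sub>R y + (1 - u) *\<^sub>R x \<in> X"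
      using convexD[OF insert.prems(3) xy(2,1), of u "1 - u"] u by simp
    moreover have "0 \<le> u * g z y + (1 - u) * g z x" using u xy by simp
    moreover note concave_on_segmentD[OF insert.prems(5)[OF z] xy(2,1) u]
    ultimately show "(1 - u) *\<^sub>R x + u *\<^sub>R y \<in> X \<and> 0 \<le> g z ((1 - u) *\<^sub>R x + u *\<^sub>R y)"
      by (simp add: add.commute)
  qed
  have "\<exists>y\<in>Y. \<forall>x\<in>?K. g y x < 0"
  proof (rule insert.IH)
    show "compact ?K"
      using compact_Int_closed[OF insert.prems(2) insert.prems(6)[OF z, of 0]]
      by (simp add: Int_def conj_commute cong: conj_cong)
    show "concave_on ?K (g y)" if "y \<in> Y" for y
      using convex_on_subset[OF _ _ cvK] insert.prems(5)[OF that] unfolding concave_on_def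
      by blast
    show "closed {x\<in>?K. a \<le> g y x}" if "y \<in> Y" for y a
    proof -
      have "{x\<in>?K. a \<le> g y x} = ?K \<inter> {x\<in>X. a \<le> g y x}" by auto
      then show ?thesis using insert.prems(6) z that by auto
    qed
    show "\<exists>y\<in>F. g y x < 0" if "x \<in> ?K" for x
      using insert.prems(7)[of x] that by auto
  qed (use insert.prems cvK in auto)
  then obtain y where y: "y \<in> Y" "\<And>x. x \<in> X \<Longrightarrow> 0 \<le> g z x \<Longrightarrow> g y x < 0" by auto
  obtain t where t: "0 \<le> t" "t \<le> 1" "\<And>x. x \<in> X \<Longrightarrow> t * g z x + (1 - t) * g y x < 0"
  proof (rule two_concave_functions_alternative[of X "g z" "g y"])
    show "g z x < 0 \<or> g y x < 0" if "x \<in> X" for x using y(2)[OF that] by linarith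
  qed (use insert.prems z y(1) in auto)
  have "t *\<^sub>R z + (1 - t) *\<^sub>R y \<in> Y" using convexD[OF Y(1) z y(1), of t "1 - t"] t by simp
  \<comment> \<open>Convexity in the strategy bounds the value at the mixture by the mixture of the
    values, which is negative for this \<open>t\<close>.\<close>
  moreover have "g (t *\<^sub>R z + (1 - t) *\<^sub>R y) x < 0" if "x \<in> X" for x
    using convex_on_segmentD[OF insert.prems(4)[OF that] z y(1) t(1,2)] t(3)[OF that] by linarith
  ultimately show ?case by blast
qed

text \<open>The closed sets where \<open>g y\<close> is nonnegative have no common point in
  \<open>X\<close>, so by compactness finitely many of them already have none.\<close>

lemma kneser_alternative:
  fixes g :: "'v::real_vector \<Rightarrow> 'a::{real_vector, t2_space} \<Rightarrow> real"
  assumes Y: "convex Y" "Y \<noteq> {}"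
    and X: "compact X" "convex X"
    and cvx: "\<And>x. x \<in> X \<Longrightarrow> convex_on Y (\<lambda>y. g y x)"
    and conc: "\<And>y. y \<in> Y \<Longrightarrow> concave_on X (g y)"
    and cl: "\<And>y a. y \<in> Y \<Longrightarrow> closed {x\<in>X. a \<le> g y x}"
    and neg: "\<And>x. x \<in> X \<Longrightarrow> \<exists>y\<in>Y. g y x < 0"
  shows "\<exists>y\<in>Y. \<forall>x\<in>X. g y x < 0"
proof -
  let ?C = "\<lambda>y. {x\<in>X. 0 \<le> g y x}"
  have "X \<inter> (\<Inter>y\<in>Y. ?C y) = {}" using neg by fastforce
  then obtain F where F: "finite F" "F \<subseteq> Y" "X \<inter> (\<Inter>y\<in>F. ?C y) = {}"
    using compact_imp_fip_image[OF X(1), of Y ?C] cl by blast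
  show ?thesis
  proof (rule kneser_alternative_finite[OF Y F(1,2) X cvx conc cl])
    show "\<exists>y\<in>F. g y x < 0" if "x \<in> X" for x using F(3) that by (fastforce simp: not_le)
  qed
qed

section \<open>Upper semicontinuity: attained suprema and the spread of infinite values\<close>

lemma closed_superlevel_upper_semicontinuous_on:
  assumes "closed X" "upper_semicontinuous_on X \<phi>"
  shows "closed {x\<in>X. a \<le> \<phi> x}"
  unfolding closed_limpt
proof (intro allI impI)
  fix x assume lim: "x islimpt {x\<in>X. a \<le> \<phi> x}"
  then have x: "x \<in> X" using assms(1) closed_limpt islimpt_subset by blast
  have "a \<le> \<phi> x"
  proof (rule ccontr)
    assume "\<not> a \<le> \<phi> x"
    then have "eventually (\<lambda>y. \<phi> y < a) (at x within X)"
      using assms(2) x unfolding upper_semicontinuous_on_def by auto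
    then obtain U where "open U" "x \<in> U" "\<forall>y\<in>U. y \<noteq> x \<longrightarrow> y \<in> X \<longrightarrow> \<phi> y < a"
      unfolding eventually_at_topological by blast
    with lim show False unfolding islimpt_def by (metis (mono_tags, lifting) mem_Collect_eq not_le)
  qed
  with x show "x \<in> {x\<in>X. a \<le> \<phi> x}" by simp
qed

text \<open>The superlevel sets at real levels below the supremum are closed, nonempty and nested,
  so they share a point, where the supremum is attained. Real levels suffice since they are dense in
  \<open>ereal\<close>; for supremum minus infinity there are none and any point serves.\<close>

lemma SUP_attained_closed_superlevels:
  fixes \<phi> :: "'a::t2_space \<Rightarrow> ereal"
  assumes X: "compact X" "X \<noteq> {}"
    and cl: "\<And>l. closed {x\<in>X. ereal l \<le> \<phi> x}"
  shows "\<exists>x\<in>X. \<phi> x = (SUP y\<in>X. \<phi> y)"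
proof -
  let ?M = "SUP y\<in>X. \<phi> y" and ?C = "\<lambda>l. {x\<in>X. ereal l \<le> \<phi> x}"
  have "X \<inter> (\<Inter>l\<in>{l. ereal l < ?M}. ?C l) \<noteq> {}"
  proof (rule compact_imp_fip_image[OF X(1)])
    fix F assume F: "finite F" "F \<subseteq> {l. ereal l < ?M}"
    show "X \<inter> (\<Inter>l\<in>F. ?C l) \<noteq> {}"
    proof (cases "F = {}")
      case False
      then have "ereal (Max F) < ?M" using F Max_in by blast
      then obtain x where x: "x \<in> X" "ereal (Max F) < \<phi> x" by (auto simp: less_SUP_iff)
      have "ereal l \<le> \<phi> x" if "l \<in> F" for l
        using Max_ge[OF F(1) that] x(2) by (meson ereal_less_eq(3) less_imp_le order_trans)
      with x show ?thesis by blast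
    qed (use X in auto)
  qed (use cl in auto)
  then obtain x where x: "x \<in> X" "\<And>l. ereal l < ?M \<Longrightarrow> ereal l \<le> \<phi> x" by auto
  have "?M \<le> \<phi> x"
  proof (rule ccontr)
    assume "\<not> ?M \<le> \<phi> x"
    then obtain l where "\<phi> x < ereal l" "ereal l < ?M" by (meson ereal_dense2 not_le)
    then show False using x(2) by force
  qed
  moreover have "\<phi> x \<le> ?M" using x(1) by (rule SUP_upper)
  ultimately show ?thesis using x(1) by force
qed

lemma ereal_convex_onD:
  assumes "ereal_convex_on A f" "x \<in> A" "y \<in> A" "0 < t" "t < 1"
  shows "f ((1 - t) *\<^sub>R x + t *\<^sub>R y) \<le> ereal (1 - t) * f x + ereal t * f y"
  using assms(1)[unfolded ereal_convex_on_def, rule_format, OF assms(2,3), of "1 - t"] assms(4,5)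
  by simp

lemma ereal_linear_onD:
  assumes "ereal_linear_on A f" "x \<in> A" "y \<in> A" "0 < t" "t < 1"
  shows "f ((1 - t) *\<^sub>R x + t *\<^sub>R y) = ereal (1 - t) * f x + ereal t * f y"
  using assms(1)[unfolded ereal_linear_on_def, rule_format, OF assms(2,3), of "1 - t"] assms(4,5)
  by simp

text \<open>If the value at \<open>y\<close> were finite, concavity would still make the function
  infinite at all points strictly between \<open>x\<close> and \<open>y\<close>, while upper
  semicontinuity keeps it below infinity near \<open>y\<close>.\<close>

lemma concave_upper_semicontinuous_eq_infinity:
  fixes \<phi> :: "'a::real_normed_vector \<Rightarrow> ereal"
  assumes X: "convex X" and conc: "ereal_concave_on X \<phi>" and usc: "upper_semicontinuous_on X \<phi>"
    and low: "\<And>x. x \<in> X \<Longrightarrow> - \<infinity> < \<phi> x"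
    and x: "x \<in> X" "\<phi> x = \<infinity>" and y: "y \<in> X"
  shows "\<phi> y = \<infinity>"
proof (rule ccontr)
  assume fin: "\<phi> y \<noteq> \<infinity>"
  then have "x \<noteq> y" using x by auto
  let ?z = "\<lambda>t::real. t *\<^sub>R x + (1 - t) *\<^sub>R y"
  have "eventually (\<lambda>z. \<phi> z < \<infinity>) (at y within X)"
    using usc[unfolded upper_semicontinuous_on_def, rule_format, OF y, of \<infinity>] fin
    by (simp only: ereal_infty_less) simp
  moreover have "filterlim ?z (at y within X) (at_right 0)"
    unfolding filterlim_at
  proof
    have t01: "eventually (\<lambda>t::real. t \<in> {0<..<1}) (at_right 0)"
      by (simp add: eventually_at_right_less eventually_at_right_field) (use zero_less_one in blast)
    show "eventually (\<lambda>t. ?z t \<in> X \<and> ?z t \<noteq> y) (at_right 0)"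
      using t01
    proof eventually_elim
      case (elim t)
      have "?z t \<in> X" using convexD[OF X x(1) y, of t "1 - t"] elim by simp
      moreover have "?z t - y = t *\<^sub>R (x - y)" by (simp add: algebra_simps)
      then have "?z t \<noteq> y" using elim \<open>x \<noteq> y\<close> by auto
      ultimately show ?case by simp
    qed
    have "(?z \<longlongrightarrow> 0 *\<^sub>R x + (1 - 0) *\<^sub>R y) (at_right 0)" by (intro tendsto_intros)
    then show "(?z \<longlongrightarrow> y) (at_right 0)" by simp
  qed
  ultimately have "eventually (\<lambda>t. \<phi> (?z t) < \<infinity>) (at_right 0)"
    unfolding filterlim_iff by blast
  then obtain b where b: "0 < b" "\<And>t. 0 < t \<Longrightarrow> t < b \<Longrightarrow> \<phi> (?z t) < \<infinity>"
    unfolding eventually_at_right_field by auto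
  define t where "t = min (b / 2) (1 / 2)"
  have t: "0 < t" "t < b" "t < 1" using b(1) unfolding t_def by (auto simp: min_def)
  have "- \<phi> (?z t) \<le> ereal t * (- \<phi> x) + ereal (1 - t) * (- \<phi> y)"
    using conc x(1) y t unfolding ereal_concave_on_def ereal_convex_on_def by auto
  \<comment> \<open>The assumption \<open>low\<close> matters here: if \<open>- \<phi> y\<close>
    were infinity, the sum would take the default value infinity and the bound would be
    void.\<close>
  moreover have "ereal t * (- \<phi> x) + ereal (1 - t) * (- \<phi> y) = - \<infinity>"
    using x(2) t fin low[OF y] by (cases "\<phi> y") auto
  ultimately have "- \<phi> (?z t) \<le> - \<infinity>" by (simp only:)
  then show False using b(2)[OF t(1,2)] by simp
qed

section \<open>Ratios, gaps and strategies with finite values\<close>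

lemma pos_ratio_nonneg: "0 \<le> c \<Longrightarrow> 0 \<le> pos_ratio c s"
  by (simp add: pos_ratio_def divide_ereal_def ereal_inverse_nonneg_iff)

text \<open>For \<open>s > 0\<close> multiply by \<open>s\<close>. For \<open>s <= 0\<close> both
  sides fail: the left one by the convention that division by zero gives infinity, the right one
  because \<open>l * s <= 0 <= c\<close>.\<close>

lemma pos_ratio_less_iff:
  assumes "0 \<le> c" "s < \<infinity>" "0 < l"
  shows "pos_ratio c s < ereal l \<longleftrightarrow> c < ereal l * s"
proof (cases "s \<le> 0")
  case True
  then have "ereal l * s \<le> 0" using assms(3) by (simp add: ereal_mult_le_0_iff)
  with True assms(1) show ?thesis by (auto simp: pos_ratio_def max_def)
next
  case False
  with assms obtain r where r: "s = ereal r" "0 < r" by (cases s) auto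
  show ?thesis using assms(1) r by (cases c) (auto simp: pos_ratio_def max_def field_simps)
qed

text \<open>The simplex is abstracted to a nonempty compact convex set. The assumptions on the score
  concern \<open>- s\<close>, so \<open>c\<close> and \<open>- s\<close> have the same shape, and
  \<open>c + l * (- s)\<close> inherits it for \<open>l > 0\<close>.\<close>

locale ratio_saddle =
  fixes Y :: "'v::real_vector set" and X :: "'a::real_normed_vector set"
    and c s :: "'v \<Rightarrow> 'a \<Rightarrow> ereal"
  assumes convex_Y: "convex Y"
    and compact_X: "compact X" and convex_X: "convex X" and X_nonempty: "X \<noteq> {}"
    and c_nonneg: "y \<in> Y \<Longrightarrow> x \<in> X \<Longrightarrow> 0 \<le> c y x"
    and s_less_infinity: "y \<in> Y \<Longrightarrow> x \<in> X \<Longrightarrow> s y x < \<infinity>"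
    and saddle_c: "saddle_on Y X c"
    and saddle_s: "saddle_on Y X (\<lambda>y x. - s y x)"
    and usc_c: "y \<in> Y \<Longrightarrow> upper_semicontinuous_on X (c y)"
    and usc_s: "y \<in> Y \<Longrightarrow> upper_semicontinuous_on X (\<lambda>x. - s y x)"
begin

definition ratio :: "'v \<Rightarrow> 'a \<Rightarrow> ereal" where
  "ratio y x = pos_ratio (c y x) (s y x)"

text \<open>Since \<open>c\<close> is nonnegative and \<open>s\<close> is below infinity, both are
  real-valued on all of \<open>X\<close> for these strategies.\<close>

definition finite_strategies :: "'v set" where
  "finite_strategies = {y\<in>Y. \<forall>x\<in>X. c y x < \<infinity> \<and> - \<infinity> < s y x}"

text \<open>\<open>real_of_ereal\<close> sends infinite values to 0, so this is the intended
  difference only for \<open>finite_strategies\<close>.\<close>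

definition gap :: "real \<Rightarrow> 'v \<Rightarrow> 'a \<Rightarrow> real" where
  "gap l y x = real_of_ereal (c y x) - l * real_of_ereal (s y x)"

lemma convex_c: "x \<in> X \<Longrightarrow> ereal_convex_on Y (\<lambda>y. c y x)"
  and convex_s: "x \<in> X \<Longrightarrow> ereal_convex_on Y (\<lambda>y. - s y x)"
  and concave_c: "y \<in> Y \<Longrightarrow> ereal_concave_on X (c y)"
  and concave_s: "y \<in> Y \<Longrightarrow> ereal_concave_on X (\<lambda>x. - s y x)"
  using saddle_c saddle_s unfolding saddle_on_def by auto

lemma ratio_nonneg: "y \<in> Y \<Longrightarrow> x \<in> X \<Longrightarrow> 0 \<le> ratio y x"
  unfolding ratio_def by (intro pos_ratio_nonneg c_nonneg)

lemma finite_strategies_subset: "finite_strategies \<subseteq> Y"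
  unfolding finite_strategies_def by auto

lemma finite_strategyE:
  assumes "y \<in> finite_strategies" "x \<in> X"
  obtains u v where "c y x = ereal u" "s y x = ereal v"
  using assms c_nonneg[of y x] s_less_infinity[of y x] unfolding finite_strategies_def
  by (cases "c y x"; cases "s y x") auto

text \<open>One infinite value of \<open>c y\<close> or \<open>- s y\<close> spreads over all of
  \<open>X\<close>. An infinite cost over a positive real score, or a nonpositive score, gives ratio
  infinity, so discarding such strategies changes no infimum.\<close>

lemma ratio_eq_infinity:
  assumes y: "y \<in> Y" "y \<notin> finite_strategies" and x: "x \<in> X"
  shows "ratio y x = \<infinity>"
proof -
  obtain z where z: "z \<in> X" "c y z = \<infinity> \<or> - s y z = \<infinity>"
    using y unfolding finite_strategies_def by (auto simp: ereal_uminus_eq_reorder)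
  have "c y x = \<infinity> \<or> - s y x = \<infinity>"
    using z(2)
  proof
    assume "c y z = \<infinity>"
    then have "c y x = \<infinity>"
      using concave_upper_semicontinuous_eq_infinity[OF convex_X _ usc_c[OF y(1)] _ z(1) _ x]
        concave_c[OF y(1)] c_nonneg[OF y(1)] by force
    then show ?thesis ..
  next
    assume "- s y z = \<infinity>"
    then have "- s y x = \<infinity>"
      using concave_upper_semicontinuous_eq_infinity[OF convex_X _ usc_s[OF y(1)] _ z(1) _ x]
        concave_s[OF y(1)] s_less_infinity[OF y(1)] by force
    then show ?thesis ..
  qed
  then show ?thesis
    using s_less_infinity[OF y(1) x] unfolding ratio_def pos_ratio_def
    by (cases "s y x") (auto simp: max_def)
qed

lemma ratio_less_iff_gap:
  assumes "y \<in> finite_strategies" "x \<in> X" "0 < l"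
  shows "ratio y x < ereal l \<longleftrightarrow> gap l y x < 0"
proof -
  have "y \<in> Y" using assms(1) finite_strategies_subset by auto
  moreover obtain u v where "c y x = ereal u" "s y x = ereal v" using assms by (elim finite_strategyE)
  ultimately show ?thesis
    using pos_ratio_less_iff[of "c y x" "s y x" l] c_nonneg[of y x] assms
    unfolding ratio_def gap_def by auto
qed

text \<open>Convexity in the strategy bounds \<open>c\<close> and \<open>- s\<close> at a mixture by
  real combinations, hence away from infinity.\<close>

lemma convex_finite_strategies: "convex finite_strategies"
  unfolding convex_contains_open_segment
proof (clarsimp simp: in_segment)
  fix a b and u :: real
  assume ab: "a \<in> finite_strategies" "b \<in> finite_strategies" and u: "0 < u" "u < 1"
  let ?y = "(1 - u) *\<^sub>R a + u *\<^sub>R b"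
  have abY: "a \<in> Y" "b \<in> Y" using ab finite_strategies_subset by auto
  then have "?y \<in> Y" using convexD[OF convex_Y abY, of "1 - u" u] u by simp
  moreover have "c ?y x < \<infinity> \<and> - \<infinity> < s ?y x" if x: "x \<in> X" for x
  proof -
    obtain p q p' q' where pq: "c a x = ereal p" "s a x = ereal q" "c b x = ereal p'" "s b x = ereal q'"
      using finite_strategyE[OF ab(1) x] finite_strategyE[OF ab(2) x] by metis
    from ereal_convex_onD[OF convex_c[OF x] abY u] ereal_convex_onD[OF convex_s[OF x] abY u]
    show ?thesis unfolding pq by (cases "c ?y x"; cases "s ?y x") auto
  qed
  ultimately show "?y \<in> finite_strategies" unfolding finite_strategies_def by auto
qed

lemma convex_on_gap:
  assumes x: "x \<in> X" and l: "0 < l"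
  shows "convex_on finite_strategies (\<lambda>y. gap l y x)"
proof (rule convex_onI)
  fix t :: real and a b
  assume t: "0 < t" "t < 1" and ab: "a \<in> finite_strategies" "b \<in> finite_strategies"
  let ?y = "(1 - t) *\<^sub>R a + t *\<^sub>R b"
  have abY: "a \<in> Y" "b \<in> Y" using ab finite_strategies_subset by auto
  have y: "?y \<in> finite_strategies"
    using convexD[OF convex_finite_strategies ab, of "1 - t" t] t by simp
  obtain p q where pq: "c a x = ereal p" "s a x = ereal q" using finite_strategyE[OF ab(1) x] .
  obtain p' q' where pq': "c b x = ereal p'" "s b x = ereal q'" using finite_strategyE[OF ab(2) x] .
  obtain p'' q'' where pq'': "c ?y x = ereal p''" "s ?y x = ereal q''" using finite_strategyE[OF y x] .
  have "p'' \<le> (1 - t) * p + t * p'"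
    using ereal_convex_onD[OF convex_c[OF x] abY t] by (simp add: pq pq' pq'')
  moreover have "- q'' \<le> (1 - t) * - q + t * - q'"
    using ereal_convex_onD[OF convex_s[OF x] abY t] by (simp add: pq pq' pq'')
  then have "l * - q'' \<le> l * ((1 - t) * - q + t * - q')" using l by (intro mult_left_mono) auto
  ultimately show "gap l ?y x \<le> (1 - t) * gap l a x + t * gap l b x"
    unfolding gap_def pq pq' pq'' by (simp add: algebra_simps)
qed (rule convex_finite_strategies)

lemma concave_on_gap:
  assumes y: "y \<in> finite_strategies" and l: "0 < l"
  shows "concave_on X (gap l y)"
  unfolding concave_on_def
proof (rule convex_onI)
  fix t :: real and a b
  assume t: "0 < t" "t < 1" and ab: "a \<in> X" "b \<in> X"
  let ?z = "(1 - t) *\<^sub>R a + t *\<^sub>R b"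
  have yY: "y \<in> Y" using y finite_strategies_subset by auto
  have z: "?z \<in> X" using convexD[OF convex_X ab, of "1 - t" t] t by simp
  obtain p q where pq: "c y a = ereal p" "s y a = ereal q" using finite_strategyE[OF y ab(1)] .
  obtain p' q' where pq': "c y b = ereal p'" "s y b = ereal q'" using finite_strategyE[OF y ab(2)] .
  obtain p'' q'' where pq'': "c y ?z = ereal p''" "s y ?z = ereal q''" using finite_strategyE[OF y z] .
  have "- p'' \<le> (1 - t) * - p + t * - p'"
    using ereal_convex_onD[OF concave_c[OF yY, unfolded ereal_concave_on_def] ab t]
    by (simp add: pq pq' pq'')
  moreover have "q'' \<le> (1 - t) * q + t * q'"
    using ereal_convex_onD[OF concave_s[OF yY, unfolded ereal_concave_on_def] ab t]
    by (simp add: pq pq' pq'')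
  then have "l * q'' \<le> l * ((1 - t) * q + t * q')" using l by (intro mult_left_mono) auto
  ultimately show "- gap l y ?z \<le> (1 - t) * - gap l y a + t * - gap l y b"
    unfolding gap_def pq pq' pq'' by (simp add: algebra_simps)
qed (rule convex_X)

lemma closed_gap_superlevel:
  assumes y: "y \<in> finite_strategies" and l: "0 < l"
  shows "closed {x\<in>X. a \<le> gap l y x}"
proof -
  have yY: "y \<in> Y" using y finite_strategies_subset by auto
  have "upper_semicontinuous_on X (\<lambda>x. ereal (gap l y x))"
    unfolding upper_semicontinuous_on_def
  proof (intro ballI allI impI)
    fix x b assume x: "x \<in> X" and b: "ereal (gap l y x) < b"
    then obtain r where r: "gap l y x < r" "ereal r < b" by (metis ereal_dense2 less_ereal.simps(1))
    \<comment> \<open>Half of the margin goes to the cost and half to the score, whose share becomes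
      \<open>e / l\<close> because \<open>- s\<close> is multiplied by \<open>l\<close>.\<close>
    define e where "e = (r - gap l y x) / 2"
    have e: "0 < e" using r unfolding e_def by simp
    obtain p q where pq: "c y x = ereal p" "s y x = ereal q" using finite_strategyE[OF y x] .
    have "eventually (\<lambda>z. c y z < ereal (p + e)) (at x within X)"
      using usc_c[OF yY] x e pq unfolding upper_semicontinuous_on_def by auto
    moreover have "eventually (\<lambda>z. - s y z < ereal (- q + e / l)) (at x within X)"
      using usc_s[OF yY, unfolded upper_semicontinuous_on_def, rule_format, OF x, of "ereal (- q + e / l)"]
        e l pq by simp
    moreover have "eventually (\<lambda>z. z \<in> X) (at x within X)"
      unfolding eventually_at_filter by simp
    ultimately show "eventually (\<lambda>z. ereal (gap l y z) < b) (at x within X)"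
    proof eventually_elim
      case (elim z)
      obtain p' q' where pq': "c y z = ereal p'" "s y z = ereal q'" using finite_strategyE[OF y elim(3)] .
      have "p' < p + e" "- q' < - q + e / l" using elim unfolding pq' by auto
      moreover from this(2) have "l * - q' < l * - q + e" using l by (simp add: field_simps)
      ultimately have "gap l y z < gap l y x + 2 * e" unfolding gap_def pq pq' by simp
      then have "gap l y z < r" unfolding e_def by (simp add: field_simps)
      then show ?case using r(2) by (meson less_ereal.simps(1) less_trans)
    qed
  qed
  from closed_superlevel_upper_semicontinuous_on[OF compact_imp_closed[OF compact_X] this, of "ereal a"]
  show ?thesis by simp
qed

text \<open>For \<open>l > 0\<close> and a finite strategy this is a superlevel set of the gap.
  Otherwise it is all of \<open>X\<close>, as the ratio is infinite or
  \<open>l <= 0\<close>.\<close>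

lemma closed_ratio_superlevel:
  assumes y: "y \<in> Y"
  shows "closed {x\<in>X. ereal l \<le> ratio y x}"
proof (cases "0 < l \<and> y \<in> finite_strategies")
  case True
  then have "{x\<in>X. ereal l \<le> ratio y x} = {x\<in>X. 0 \<le> gap l y x}"
    using ratio_less_iff_gap[of y _ l] by (auto simp: not_less[symmetric])
  then show ?thesis using closed_gap_superlevel True by simp
next
  case False
  have "ereal l \<le> ratio y x" if x: "x \<in> X" for x
  proof (cases "y \<in> finite_strategies")
    case True
    with False have "ereal l \<le> 0" by simp
    then show ?thesis using ratio_nonneg[OF y x] by (rule order_trans)
  qed (use ratio_eq_infinity[OF y _ x] in simp)
  then have "{x\<in>X. ereal l \<le> ratio y x} = X" by auto
  then show ?thesis using compact_imp_closed[OF compact_X] by simp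
qed

section \<open>Attained maxima, the minimax equality and reduction to vertices\<close>

lemma SUP_ratio_attained:
  "y \<in> Y \<Longrightarrow> \<exists>x\<in>X. ratio y x = (SUP z\<in>X. ratio y z)"
  by (intro SUP_attained_closed_superlevels compact_X X_nonempty closed_ratio_superlevel)

lemma SUP_INF_ratio_attained:
  "\<exists>x\<in>X. (INF y\<in>Y. ratio y x) = (SUP z\<in>X. INF y\<in>Y. ratio y z)"
proof (intro SUP_attained_closed_superlevels compact_X X_nonempty)
  fix l
  \<comment> \<open>A superlevel set of an infimum is the intersection of the superlevel sets, hence
    closed.\<close>
  have "{x\<in>X. ereal l \<le> (INF y\<in>Y. ratio y x)} = X \<inter> (\<Inter>y\<in>Y. {x\<in>X. ereal l \<le> ratio y x})"
    by (auto simp: le_INF_iff)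
  then show "closed {x\<in>X. ereal l \<le> (INF y\<in>Y. ratio y x)}"
    using compact_imp_closed[OF compact_X] closed_ratio_superlevel by (auto intro!: closed_Int closed_INT)
qed

theorem minimax_ratio: "(INF y\<in>Y. SUP x\<in>X. ratio y x) = (SUP x\<in>X. INF y\<in>Y. ratio y x)"
proof (rule antisym)
  show "(SUP x\<in>X. INF y\<in>Y. ratio y x) \<le> (INF y\<in>Y. SUP x\<in>X. ratio y x)"
    by (intro SUP_least INF_greatest) (meson INF_lower SUP_upper order_trans)
  show "(INF y\<in>Y. SUP x\<in>X. ratio y x) \<le> (SUP x\<in>X. INF y\<in>Y. ratio y x)"
  proof (rule ccontr)
    assume "\<not> ?thesis"
    \<comment> \<open>A real level strictly between the two sides turns ratios into gaps. It is
      positive because ratios are nonnegative, as the translation requires.\<close>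
    then obtain l where l: "(SUP x\<in>X. INF y\<in>Y. ratio y x) < ereal l"
      "ereal l < (INF y\<in>Y. SUP x\<in>X. ratio y x)" by (meson ereal_dense2 not_le)
    obtain x0 where x0: "x0 \<in> X" using X_nonempty by auto
    have "0 \<le> (INF y\<in>Y. ratio y x0)" by (intro INF_greatest ratio_nonneg x0)
    also have "\<dots> \<le> (SUP x\<in>X. INF y\<in>Y. ratio y x)" using x0 by (rule SUP_upper)
    finally have l0: "0 < l" using l(1) by (metis ereal_less(2) order_le_less_trans)
    have neg: "\<exists>y\<in>finite_strategies. gap l y x < 0" if x: "x \<in> X" for x
    proof -
      have "(INF y\<in>Y. ratio y x) < ereal l" using l(1) SUP_upper[OF x] by (rule order_le_less_trans[rotated])
      then obtain y where y: "y \<in> Y" "ratio y x < ereal l" by (auto simp: INF_less_iff)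
      then have "y \<in> finite_strategies" using ratio_eq_infinity[OF y(1) _ x] by force
      then show ?thesis using ratio_less_iff_gap x l0 y(2) by blast
    qed
    then have "finite_strategies \<noteq> {}" using x0 by auto
    then obtain y where y: "y \<in> finite_strategies" "\<forall>x\<in>X. gap l y x < 0"
      using kneser_alternative[of finite_strategies X "gap l"] neg convex_finite_strategies compact_X
        convex_X convex_on_gap concave_on_gap closed_gap_superlevel l0 by blast
    \<comment> \<open>The single strategy found has ratio below \<open>l\<close> throughout
      \<open>X\<close>, so the infimum of suprema is at most \<open>l\<close>, against its
      choice.\<close>
    then have "(SUP x\<in>X. ratio y x) \<le> ereal l"
      using ratio_less_iff_gap l0 by (intro SUP_least) (simp add: less_imp_le)
    moreover have "(INF y\<in>Y. SUP x\<in>X. ratio y x) \<le> (SUP x\<in>X. ratio y x)"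
      using y(1) finite_strategies_subset by (intro INF_lower) auto
    ultimately show False using l(2) by simp
  qed
qed

text \<open>The ratio need not be linear, but its gap is affine. At a level above all vertex ratios,
  the points with negative gap form a convex set containing \<open>V\<close>, hence all of
  \<open>X\<close>.\<close>

lemma SUP_ratio_convex_hull:
  assumes y: "y \<in> Y" and lin: "ereal_linear_on X (c y)" "ereal_linear_on X (s y)"
    and V: "X = convex hull V"
  shows "(SUP x\<in>V. ratio y x) = (SUP x\<in>X. ratio y x)"
proof (rule antisym)
  have VX: "V \<subseteq> X" unfolding V by (rule hull_subset)
  then show "(SUP x\<in>V. ratio y x) \<le> (SUP x\<in>X. ratio y x)" by (rule SUP_subset_mono) simp
  show "(SUP x\<in>X. ratio y x) \<le> (SUP x\<in>V. ratio y x)"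
  proof (rule ccontr)
    assume "\<not> ?thesis"
    then obtain l where l: "(SUP x\<in>V. ratio y x) < ereal l" "ereal l < (SUP x\<in>X. ratio y x)"
      by (meson ereal_dense2 not_le)
    have "V \<noteq> {}" using X_nonempty V by auto
    then obtain x0 where x0: "x0 \<in> V" by auto
    have "0 \<le> ratio y x0" using y x0 VX by (intro ratio_nonneg) auto
    also have "\<dots> \<le> (SUP x\<in>V. ratio y x)" using x0 by (rule SUP_upper)
    finally have l0: "0 < l" using l(1) by (metis ereal_less(2) order_le_less_trans)
    have Vl: "ratio y x < ereal l" if "x \<in> V" for x
      using l(1) SUP_upper[OF that] by (rule order_le_less_trans[rotated])
    \<comment> \<open>A finite ratio at one vertex makes all values of \<open>c y\<close> and
      \<open>s y\<close> real, so the linearity identities hold in the reals.\<close>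
    then have yf: "y \<in> finite_strategies" using ratio_eq_infinity[OF y, of x0] x0 VX by force
    let ?A = "{x\<in>X. gap l y x < 0}"
    have "convex ?A"
      unfolding convex_contains_open_segment
    proof (clarsimp simp: in_segment)
      fix a b and u :: real
      assume ab: "a \<in> X" "b \<in> X" "gap l y a < 0" "gap l y b < 0" and u: "0 < u" "u < 1"
      let ?z = "(1 - u) *\<^sub>R a + u *\<^sub>R b"
      have z: "?z \<in> X" using convexD[OF convex_X ab(1,2), of "1 - u" u] u by simp
      obtain p q where pq: "c y a = ereal p" "s y a = ereal q" using finite_strategyE[OF yf ab(1)] .
      obtain p' q' where pq': "c y b = ereal p'" "s y b = ereal q'" using finite_strategyE[OF yf ab(2)] .
      have "c y ?z = ereal ((1 - u) * p + u * p')" "s y ?z = ereal ((1 - u) * q + u * q')"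
        using ereal_linear_onD[OF lin(1) ab(1,2) u] ereal_linear_onD[OF lin(2) ab(1,2) u]
        by (simp_all add: pq pq')
      then have "gap l y ?z = (1 - u) * gap l y a + u * gap l y b"
        unfolding gap_def pq pq' by (simp add: algebra_simps)
      also have "\<dots> < 0" using u ab by (intro add_neg_neg mult_pos_neg) auto
      finally show "?z \<in> X \<and> gap l y ?z < 0" using z by simp
    qed
    moreover have "V \<subseteq> ?A" using Vl VX ratio_less_iff_gap[OF yf _ l0] by auto
    ultimately have "X \<subseteq> ?A" unfolding V by (rule hull_minimal[rotated])
    then have "(SUP x\<in>X. ratio y x) \<le> ereal l"
      using ratio_less_iff_gap[OF yf _ l0] by (intro SUP_least) (auto intro: less_imp_le)
    with l(2) show False by simp
  qed
qed

end

section \<open>The probability simplex and the final statement\<close>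

lemma prob_simplex_eq_convex_hull: "prob_simplex = convex hull range (\<lambda>x. axis x 1)"
proof
  show "prob_simplex \<subseteq> convex hull range (\<lambda>x. axis x (1::real))"
  proof
    fix \<mu> :: "real ^ 's" assume \<mu>: "\<mu> \<in> prob_simplex"
    \<comment> \<open>The basis expansion of a distribution is itself a convex combination of point
      masses, with its coordinates as weights.\<close>
    have "(\<Sum>x\<in>UNIV. \<mu> $ x *\<^sub>R axis x 1) \<in> convex hull range (\<lambda>x. axis x (1::real))"
      using \<mu> unfolding prob_simplex_def by (intro convex_sum) (auto intro: hull_inc)
    then show "\<mu> \<in> convex hull range (\<lambda>x. axis x 1)"
      using basis_expansion[of \<mu>] by (simp add: scalar_mult_eq_scaleR)
  qed
  show "convex hull range (\<lambda>x. axis x (1::real)) \<subseteq> prob_simplex"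
  proof (rule hull_minimal)
    show "range (\<lambda>x. axis x (1::real)) \<subseteq> prob_simplex"
      by (auto simp: prob_simplex_def axis_def)
    show "convex (prob_simplex :: (real ^ 's) set)"
      unfolding convex_def prob_simplex_def
      by (auto simp: sum.distrib sum_distrib_left[symmetric])
  qed
qed

theorem theorem2p18:
  fixes \<R> :: "'v::real_topological_vector_space set"
    and cost score :: "'v \<Rightarrow> real ^ 's::finite \<Rightarrow> ereal"
  defines "\<Delta> \<equiv> (prob_simplex :: (real ^ 's) set)"
  assumes "convex \<R>"
    and "\<forall>R\<in>\<R>. \<forall>\<mu>\<in>\<Delta>. 0 \<le> cost R \<mu>"
    and "\<forall>R\<in>\<R>. \<forall>\<mu>\<in>\<Delta>. score R \<mu> < \<infinity>"
    and "semicontinuous_on \<R> \<Delta> cost"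
    and "saddle_on \<R> \<Delta> cost"
    and "semicontinuous_on \<R> \<Delta> (\<lambda>R \<mu>. - score R \<mu>)"
    and "saddle_on \<R> \<Delta> (\<lambda>R \<mu>. - score R \<mu>)"
    and "well_behaved \<R> \<Delta> cost score"
  shows "((INF R\<in>\<R>. SUP \<mu>\<in>\<Delta>. pos_ratio (cost R \<mu>) (score R \<mu>))
            = (SUP \<mu>\<in>\<Delta>. INF R\<in>\<R>. pos_ratio (cost R \<mu>) (score R \<mu>))
        \<and> (\<forall>R\<in>\<R>. \<exists>\<mu>\<in>\<Delta>. pos_ratio (cost R \<mu>) (score R \<mu>)
              = (SUP \<nu>\<in>\<Delta>. pos_ratio (cost R \<nu>) (score R \<nu>)))
        \<and> (\<exists>\<mu>\<in>\<Delta>. (INF R\<in>\<R>. pos_ratio (cost R \<mu>) (score R \<mu>))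
              = (SUP \<nu>\<in>\<Delta>. INF R\<in>\<R>. pos_ratio (cost R \<nu>) (score R \<nu>))))
      \<and> ((\<forall>R\<in>\<R>. ereal_linear_on \<Delta> (cost R) \<and> ereal_linear_on \<Delta> (score R)) \<longrightarrow>
          (INF R\<in>\<R>. SUP x\<in>(UNIV :: 's set). pos_ratio (cost R (axis x 1)) (score R (axis x 1)))
            = (SUP \<mu>\<in>\<Delta>. INF R\<in>\<R>. pos_ratio (cost R \<mu>) (score R \<mu>))
        \<and> (\<forall>R\<in>\<R>. \<exists>x::'s. pos_ratio (cost R (axis x 1)) (score R (axis x 1))
              = (SUP y\<in>(UNIV :: 's set). pos_ratio (cost R (axis y 1)) (score R (axis y 1))))
        \<and> (\<exists>\<mu>\<in>\<Delta>. (INF R\<in>\<R>. pos_ratio (cost R \<mu>) (score R \<mu>))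
              = (SUP \<nu>\<in>\<Delta>. INF R\<in>\<R>. pos_ratio (cost R \<nu>) (score R \<nu>))))"
proof -
  have hull: "\<Delta> = convex hull range (\<lambda>x. axis x 1)"
    unfolding \<Delta>_def by (rule prob_simplex_eq_convex_hull)
  interpret ratio_saddle \<R> \<Delta> cost score
  proof
    show "compact \<Delta>" unfolding hull by (intro finite_imp_compact_convex_hull) simp
    show "convex \<Delta>" unfolding hull by (rule convex_convex_hull)
    show "\<Delta> \<noteq> {}" unfolding hull by simp
  qed (use assms in \<open>auto simp: semicontinuous_on_def\<close>)
  have vertices: "(SUP x\<in>UNIV. ratio R (axis x 1)) = (SUP \<mu>\<in>\<Delta>. ratio R \<mu>)"
    if "R \<in> \<R>" "ereal_linear_on \<Delta> (cost R)" "ereal_linear_on \<Delta> (score R)" for R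
    using SUP_ratio_convex_hull[OF that hull] by (simp add: image_image)
  have vertex_max: "\<exists>x. ratio R (axis x 1) = (SUP y\<in>UNIV. ratio R (axis y 1))" for R
  proof -
    \<comment> \<open>There are finitely many point masses, so the supremum over them is a maximum,
      with or without linearity.\<close>
    have "Max (range (\<lambda>x. ratio R (axis x 1))) \<in> range (\<lambda>x. ratio R (axis x 1))"
      by (intro Max_in) auto
    moreover have "Max (range (\<lambda>x. ratio R (axis x 1))) = (SUP y\<in>UNIV. ratio R (axis y 1))"
      by (intro Max_Sup) auto
    ultimately show ?thesis by force
  qed
  show ?thesis
    unfolding ratio_def[symmetric]
  proof (intro conjI impI ballI)
    assume "\<forall>R\<in>\<R>. ereal_linear_on \<Delta> (cost R) \<and> ereal_linear_on \<Delta> (score R)"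
    then show "(INF R\<in>\<R>. SUP x\<in>UNIV. ratio R (axis x 1)) = (SUP \<mu>\<in>\<Delta>. INF R\<in>\<R>. ratio R \<mu>)"
      using vertices minimax_ratio by (simp cong: INF_cong)
  qed (use minimax_ratio SUP_ratio_attained SUP_INF_ratio_attained vertex_max in auto)
qed

end
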